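(* Let $(\mathfrak g,\mu,T)$ be a Rota-Baxter $3$-Lie algebra of weight $\lambda$. If the second cohomology group of the Rota-Baxter $3$-Lie algebra $(\mathfrak g,\mu,T)$ with coefficients in its adjoint representation vanishes, then $(\mathfrak g,\mu,T)$ is rigid, i.e. every $1$-parameter formal deformation of $(\mathfrak g,\mu,T)$ is trivial.
   Context: Let $k$ be a field of characteristic $0$; vector spaces are over $k$; $\lambda\in k$. A $3$-Lie algebra is a vector space $\mathfrak g$ with a linear map $\mu=[\cdot,\cdot,\cdot]:\wedge^3\mathfrak g\to\mathfrak g$ such that $[x_1,x_2,[x_3,x_4,x_5]]=[[x_1,x_2,x_3],x_4,x_5]+[x_3,[x_1,x_2,x_4],x_5]+[x_3,x_4,[x_1,x_2,x_5]]$. A Rota-Baxter $3$-Lie algebra of weight $\lambda$ is a $3$-Lie algebra with a linear map $T:\mathfrak g\to\mathfrak g$ such that $[T(x),T(y),T(z)]=T([x,y,z]_T)$, where $[x,y,z]_T:=[T(x),T(y),z]+[T(x),y,T(z)]+[x,T(y),T(z)]+\lambda[T(x),y,z]+\lambda[x,T(y),z]+\lambda[x,y,T(z)]+\lambda^2[x,y,z]$. The same definitions are used over the ring $k[[t]]$. A $1$-parameter formal deformation of $(\mathfrak g,\mu,T)$ is a pair of power series $\mu_t=\sum_{i\ge0}\mu_it^i$, $T_t=\sum_{i\ge0}T_it^i$ with $\mu_i\in\mathrm{Hom}(\wedge^3\mathfrak g,\mathfrak g)$, $T_i\in\mathrm{Hom}(\mathfrak g,\mathfrak g)$, which (extended $k[[t]]$-linearly)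 endow $\mathfrak g[[t]]$ with the structure of a Rota-Baxter $3$-Lie algebra of weight $\lambda$ over $k[[t]]$, and such that $(\mu_0,T_0)=(\mu,T)$. Two deformations $(\mu_t,T_t)$, $(\mu_t',T_t')$ are equivalent if there is a power series $\psi_t=\sum_{i\ge0}\psi_it^i$ with linear maps $\psi_i:\mathfrak g\to\mathfrak g$, $\psi_0=\mathrm{Id}_{\mathfrak g}$, such that (extended $k[[t]]$-linearly) $\psi_t\circ\mu_t'=\mu_t\circ(\psi_t\otimes\psi_t\otimes\psi_t)$ and $\psi_t\circ T_t'=T_t\circ\psi_t$. A deformation is trivial if it is equivalent to the constant deformation $\mu_t=\mu$, $T_t=T$. Second cohomology group (adjoint coefficients). Put $\rho(x,y)z=[x,y,z]$ and $\rho_T(x,y)z=[T(x),T(y),z]-T\big([T(x),y,z]+[x,T(y),z]+\lambda[x,y,z]\big)$. The $1$-cochains are $\mathrm{Hom}(\mathfrak g,\mathfrak g)\oplus\mathfrak g$ and the $2$-cochains are $\mathrm{Hom}(\wedge^3\mathfrak g,\mathfrak g)\oplus\mathrm{Hom}(\mathfrak g,\mathfrak g)$. The differentials are $d^1(f,a)=(\delta^1f,-\partial^0a-\Phi^1f)$ with $\partial^0=0$, and $d^2(f,g)=(\delta^2f,-\partial^1g-\Phi^2f)$, where $(\delta^1f)(x,y,z)=-f([x,y,z])+\rho(x,y)f(z)+\rho(y,z)f(x)+\rho(z,x)f(y)$; $\Phi^1f=f\circ T-T\circ f$; $(\delta^2f)(x_1,\dots,x_5)=-f([x_1,x_2,x_3],x_4,x_5)-f(x_3,[x_1,x_2,x_4],x_5)-f(x_3,x_4,[x_1,x_2,x_5])+f(x_1,x_2,[x_3,x_4,x_5])+\rho(x_1,x_2)f(x_3,x_4,x_5)-\rho(x_3,x_4)f(x_1,x_2,x_5)-\rho(x_4,x_5)f(x_1,x_2,x_3)-\rho(x_5,x_3)f(x_1,x_2,x_4)$;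 $(\partial^1g)(x,y,z)=-g([x,y,z]_T)+\rho_T(x,y)g(z)+\rho_T(y,z)g(x)+\rho_T(z,x)g(y)$; $(\Phi^2f)(x,y,z)=f(T(x),T(y),T(z))-T\big(f(T(x),T(y),z)+f(T(x),y,T(z))+f(x,T(y),T(z))+\lambda f(T(x),y,z)+\lambda f(x,T(y),z)+\lambda f(x,y,T(z))+\lambda^2f(x,y,z)\big)$. The second cohomology group is $\ker d^2/\operatorname{im}d^1$. *)

theory Defs
  imports
    Complex_Main
    "HOL-Computational_Algebra.Formal_Power_Series"
    "HOL-Library.Function_Algebras"
    "HOL-Library.Product_Plus"
    "HOL-Algebra.Elementary_Groups"
begin

section \<open>Rota-Baxter 3-Lie algebras over a commutative ring\<close>

text \<open>The same definitions serve for a vector space over \<open>k\<close> and for a module over \<open>k[[t]]\<close>: over a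
  field, \<^locale>\<open>module\<close> is the notion of vector space.\<close>

definition Hom1 :: "('r::comm_ring_1 \<Rightarrow> 'm::ab_group_add \<Rightarrow> 'm) \<Rightarrow> ('m \<Rightarrow> 'm) set"
  where "Hom1 scale = {f. module_hom scale scale f}"

text \<open>\<open>Hom(\<and>\<^sup>3 M, M)\<close>, through the universal property of the exterior power: trilinear maps that
  vanish whenever two arguments coincide.\<close>

definition Hom3 :: "('r::comm_ring_1 \<Rightarrow> 'm::ab_group_add \<Rightarrow> 'm) \<Rightarrow> ('m \<Rightarrow> 'm \<Rightarrow> 'm \<Rightarrow> 'm) set"
  where "Hom3 scale = {f.
    (\<forall>y z. module_hom scale scale (\<lambda>x. f x y z)) \<and>
    (\<forall>x z. module_hom scale scale (\<lambda>y. f x y z)) \<and>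
    (\<forall>x y. module_hom scale scale (\<lambda>z. f x y z)) \<and>
    (\<forall>x y. f x x y = 0 \<and> f x y x = 0 \<and> f y x x = 0)}"

locale lie3_algebra = module scale
  for scale :: "'r::comm_ring_1 \<Rightarrow> 'm::ab_group_add \<Rightarrow> 'm" +
  fixes br :: "'m \<Rightarrow> 'm \<Rightarrow> 'm \<Rightarrow> 'm"
  assumes br_Hom3: "br \<in> Hom3 scale"
    and fundamental_identity:
      "br x1 x2 (br x3 x4 x5) =
         br (br x1 x2 x3) x4 x5 + br x3 (br x1 x2 x4) x5 + br x3 x4 (br x1 x2 x5)"

definition br_T ::
  "('r::comm_ring_1 \<Rightarrow> 'm::ab_group_add \<Rightarrow> 'm) \<Rightarrow> 'r \<Rightarrow> ('m \<Rightarrow> 'm \<Rightarrow> 'm \<Rightarrow> 'm) \<Rightarrow> ('m \<Rightarrow> 'm)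
    \<Rightarrow> 'm \<Rightarrow> 'm \<Rightarrow> 'm \<Rightarrow> 'm"
  where "br_T scale lam br T x y z =
    br (T x) (T y) z + br (T x) y (T z) + br x (T y) (T z)
    + scale lam (br (T x) y z) + scale lam (br x (T y) z) + scale lam (br x y (T z))
    + scale (lam\<^sup>2) (br x y z)"

locale rota_baxter_lie3_algebra = lie3_algebra scale br
  for scale :: "'r::comm_ring_1 \<Rightarrow> 'm::ab_group_add \<Rightarrow> 'm" and br +
  fixes lam :: 'r and T :: "'m \<Rightarrow> 'm"
  assumes T_Hom1: "T \<in> Hom1 scale"
    and rota_baxter: "br (T x) (T y) (T z) = T (br_T scale lam br T x y z)"

section \<open>Second cohomology group with adjoint coefficients\<close>

context
  fixes scale :: "'k::field \<Rightarrow> 'g::ab_group_add \<Rightarrow> 'g"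
    and br :: "'g \<Rightarrow> 'g \<Rightarrow> 'g \<Rightarrow> 'g"
    and lam :: 'k
    and T :: "'g \<Rightarrow> 'g"
begin

definition rho :: "'g \<Rightarrow> 'g \<Rightarrow> 'g \<Rightarrow> 'g"
  where "rho x y z = br x y z"

definition rho_T :: "'g \<Rightarrow> 'g \<Rightarrow> 'g \<Rightarrow> 'g"
  where "rho_T x y z = br (T x) (T y) z - T (br (T x) y z + br x (T y) z + scale lam (br x y z))"

definition cochains1 :: "(('g \<Rightarrow> 'g) \<times> 'g) set"
  where "cochains1 = Hom1 scale \<times> UNIV"

definition cochains2 :: "(('g \<Rightarrow> 'g \<Rightarrow> 'g \<Rightarrow> 'g) \<times> ('g \<Rightarrow> 'g)) set"
  where "cochains2 = Hom3 scale \<times> Hom1 scale"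

definition delta1 :: "('g \<Rightarrow> 'g) \<Rightarrow> 'g \<Rightarrow> 'g \<Rightarrow> 'g \<Rightarrow> 'g"
  where "delta1 f x y z = - f (br x y z) + rho x y (f z) + rho y z (f x) + rho z x (f y)"

definition delta2 :: "('g \<Rightarrow> 'g \<Rightarrow> 'g \<Rightarrow> 'g) \<Rightarrow> 'g \<Rightarrow> 'g \<Rightarrow> 'g \<Rightarrow> 'g \<Rightarrow> 'g \<Rightarrow> 'g"
  where "delta2 f x1 x2 x3 x4 x5 =
    - f (br x1 x2 x3) x4 x5 - f x3 (br x1 x2 x4) x5 - f x3 x4 (br x1 x2 x5) + f x1 x2 (br x3 x4 x5)
    + rho x1 x2 (f x3 x4 x5) - rho x3 x4 (f x1 x2 x5) - rho x4 x5 (f x1 x2 x3) - rho x5 x3 (f x1 x2 x4)"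

definition partial0 :: "'g \<Rightarrow> 'g \<Rightarrow> 'g"
  where "partial0 a = 0"

definition partial1 :: "('g \<Rightarrow> 'g) \<Rightarrow> 'g \<Rightarrow> 'g \<Rightarrow> 'g \<Rightarrow> 'g"
  where "partial1 g x y z =
    - g (br_T scale lam br T x y z) + rho_T x y (g z) + rho_T y z (g x) + rho_T z x (g y)"

definition Phi1 :: "('g \<Rightarrow> 'g) \<Rightarrow> 'g \<Rightarrow> 'g"
  where "Phi1 f = (f \<circ> T) - (T \<circ> f)"

definition Phi2 :: "('g \<Rightarrow> 'g \<Rightarrow> 'g \<Rightarrow> 'g) \<Rightarrow> 'g \<Rightarrow> 'g \<Rightarrow> 'g \<Rightarrow> 'g"
  where "Phi2 f x y z = f (T x) (T y) (T z) - T (br_T scale lam f T x y z)"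

definition d1 :: "('g \<Rightarrow> 'g) \<times> 'g \<Rightarrow> ('g \<Rightarrow> 'g \<Rightarrow> 'g \<Rightarrow> 'g) \<times> ('g \<Rightarrow> 'g)"
  where "d1 = (\<lambda>(f, a). (delta1 f, - partial0 a - Phi1 f))"

definition d2 :: "('g \<Rightarrow> 'g \<Rightarrow> 'g \<Rightarrow> 'g) \<times> ('g \<Rightarrow> 'g)
    \<Rightarrow> ('g \<Rightarrow> 'g \<Rightarrow> 'g \<Rightarrow> 'g \<Rightarrow> 'g \<Rightarrow> 'g) \<times> ('g \<Rightarrow> 'g \<Rightarrow> 'g \<Rightarrow> 'g)"
  where "d2 = (\<lambda>(f, g). (delta2 f, - partial1 g - Phi2 f))"

definition cocycles2 :: "(('g \<Rightarrow> 'g \<Rightarrow> 'g \<Rightarrow> 'g) \<times> ('g \<Rightarrow> 'g)) set"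
  where "cocycles2 = {c \<in> cochains2. d2 c = 0}"

definition coboundaries2 :: "(('g \<Rightarrow> 'g \<Rightarrow> 'g \<Rightarrow> 'g) \<times> ('g \<Rightarrow> 'g)) set"
  where "coboundaries2 = d1 ` cochains1"

text \<open>Addition of cochains is the pointwise one, supplied by the type class instances for functions
  and pairs.\<close>

definition cohomology2 :: "(('g \<Rightarrow> 'g \<Rightarrow> 'g \<Rightarrow> 'g) \<times> ('g \<Rightarrow> 'g)) set monoid"
  where "cohomology2 =
    \<lparr>carrier = cocycles2, monoid.mult = (+), one = 0\<rparr> Mod coboundaries2"

end

section \<open>Formal deformations\<close>

text \<open>The space \<open>\<gg>[[t]]\<close> is the type \<open>'g fps\<close>; a family \<open>(f\<^sub>i)\<close> of (tri)linear maps on \<open>\<gg>\<close> acts on it by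
  the convolution formulas that extend \<open>\<Sum>\<^sub>i f\<^sub>i t\<^sup>i\<close> by \<open>k[[t]]\<close>-linearity to infinite
  series.\<close>

definition fps_scale ::
  "('k::field \<Rightarrow> 'g::ab_group_add \<Rightarrow> 'g) \<Rightarrow> 'k fps \<Rightarrow> 'g fps \<Rightarrow> 'g fps"
  where "fps_scale scale a v =
    Abs_fps (\<lambda>n. \<Sum>i\<le>n. scale (fps_nth a i) (fps_nth v (n - i)))"

definition ext1 :: "(nat \<Rightarrow> 'g::ab_group_add \<Rightarrow> 'g) \<Rightarrow> 'g fps \<Rightarrow> 'g fps"
  where "ext1 f X = Abs_fps (\<lambda>n. \<Sum>i\<le>n. f i (fps_nth X (n - i)))"

definition ext3 ::
  "(nat \<Rightarrow> 'g::ab_group_add \<Rightarrow> 'g \<Rightarrow> 'g \<Rightarrow> 'g) \<Rightarrow> 'g fps \<Rightarrow> 'g fps \<Rightarrow> 'g fps \<Rightarrow> 'g fps"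
  where "ext3 f X Y Z = Abs_fps (\<lambda>n. \<Sum>i\<le>n. \<Sum>p\<le>n - i. \<Sum>q\<le>n - i - p.
    f i (fps_nth X p) (fps_nth Y q) (fps_nth Z (n - i - p - q)))"

definition formal_deformation ::
  "('k::field \<Rightarrow> 'g::ab_group_add \<Rightarrow> 'g) \<Rightarrow> ('g \<Rightarrow> 'g \<Rightarrow> 'g \<Rightarrow> 'g) \<Rightarrow> 'k \<Rightarrow> ('g \<Rightarrow> 'g)
    \<Rightarrow> (nat \<Rightarrow> 'g \<Rightarrow> 'g \<Rightarrow> 'g \<Rightarrow> 'g) \<Rightarrow> (nat \<Rightarrow> 'g \<Rightarrow> 'g) \<Rightarrow> bool"
  where "formal_deformation scale mu lam T mu_t T_t \<longleftrightarrow>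
    (\<forall>i. mu_t i \<in> Hom3 scale) \<and> (\<forall>i. T_t i \<in> Hom1 scale) \<and>
    rota_baxter_lie3_algebra (fps_scale scale) (ext3 mu_t) (fps_const lam) (ext1 T_t) \<and>
    mu_t 0 = mu \<and> T_t 0 = T"

definition equivalent_deformations ::
  "('k::field \<Rightarrow> 'g::ab_group_add \<Rightarrow> 'g)
    \<Rightarrow> (nat \<Rightarrow> 'g \<Rightarrow> 'g \<Rightarrow> 'g \<Rightarrow> 'g) \<times> (nat \<Rightarrow> 'g \<Rightarrow> 'g)
    \<Rightarrow> (nat \<Rightarrow> 'g \<Rightarrow> 'g \<Rightarrow> 'g \<Rightarrow> 'g) \<times> (nat \<Rightarrow> 'g \<Rightarrow> 'g) \<Rightarrow> bool"
  where "equivalent_deformations scale = (\<lambda>(mu_t, T_t) (mu_t', T_t').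
    \<exists>psi. (\<forall>i. psi i \<in> Hom1 scale) \<and> psi 0 = id \<and>
      (\<forall>X Y Z. ext1 psi (ext3 mu_t' X Y Z) = ext3 mu_t (ext1 psi X) (ext1 psi Y) (ext1 psi Z)) \<and>
      ext1 psi \<circ> ext1 T_t' = ext1 T_t \<circ> ext1 psi)"

text \<open>The family of coefficients of a constant power series; in the second clause, \<open>0\<close> is the zero map.\<close>

definition const_series :: "'a::zero \<Rightarrow> nat \<Rightarrow> 'a"
  where "const_series c i = (if i = 0 then c else 0)"

definition trivial_deformation ::
  "('k::field \<Rightarrow> 'g::ab_group_add \<Rightarrow> 'g) \<Rightarrow> ('g \<Rightarrow> 'g \<Rightarrow> 'g \<Rightarrow> 'g) \<Rightarrow> ('g \<Rightarrow> 'g)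
    \<Rightarrow> (nat \<Rightarrow> 'g \<Rightarrow> 'g \<Rightarrow> 'g \<Rightarrow> 'g) \<Rightarrow> (nat \<Rightarrow> 'g \<Rightarrow> 'g) \<Rightarrow> bool"
  where "trivial_deformation scale mu T mu_t T_t \<longleftrightarrow>
    equivalent_deformations scale (mu_t, T_t) (const_series mu, const_series T)"

definition rigid ::
  "('k::field \<Rightarrow> 'g::ab_group_add \<Rightarrow> 'g) \<Rightarrow> ('g \<Rightarrow> 'g \<Rightarrow> 'g \<Rightarrow> 'g) \<Rightarrow> 'k \<Rightarrow> ('g \<Rightarrow> 'g) \<Rightarrow> bool"
  where "rigid scale mu lam T \<longleftrightarrow>
    (\<forall>mu_t T_t. formal_deformation scale mu lam T mu_t T_t
      \<longrightarrow> trivial_deformation scale mu T mu_t T_t)"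

end

(* A power series psi intertwining the constant deformation with (mu_t, T_t) is built coefficient by
   coefficient. Let E(x,y,z) = mu_t(psi x, psi y, psi z) - psi(mu(x,y,z)) and
   F(x) = T_t(psi x) - psi(T x). If E and F vanish below order n, then the coefficients of t^n in the
   fundamental and Rota-Baxter identities of (mu_t, T_t), evaluated on the series psi x, say that the
   pair of leading coefficients (E_n, F_n) is a 2-cocycle; psi is never inverted. Adding r t^n to psi
   changes this pair by d1(r, 0), so a primitive of the cocycle, with opposite sign, removes the
   obstruction. The k[[t]]-linear identities on g[[t]] follow from those on g because all operators
   involved are additive and commute with multiplication by t. *)
theory Submission
  imports Defs
begin

section \<open>Shift-linear operators on formal power series\<close>

text \<open>Multiplication by \<open>t\<close>, for coefficients in a group without multiplication.\<close>

definition fps_up :: "'a::zero fps \<Rightarrow> 'a fps"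
  where "fps_up X = Abs_fps (\<lambda>n. case n of 0 \<Rightarrow> 0 | Suc m \<Rightarrow> fps_nth X m)"

lemma fps_up_nth [simp]: "fps_nth (fps_up X) 0 = 0" "fps_nth (fps_up X) (Suc n) = fps_nth X n"
  by (simp_all add: fps_up_def)

lemma fps_const_plus_up:
  fixes X :: "'a::ab_group_add fps"
  shows "X = fps_const (fps_nth X 0) + fps_up (fps_shift 1 X)"
proof (rule fps_ext)
  fix n show "fps_nth X n = fps_nth (fps_const (fps_nth X 0) + fps_up (fps_shift 1 X)) n"
    by (cases n) simp_all
qed

lemma fps_eq_upI:
  fixes X :: "'a::ab_group_add fps"
  assumes "fps_nth X 0 = 0"
  shows "X = fps_up (fps_shift 1 X)"
  using fps_const_plus_up[of X] assms by simp

text \<open>Additivity and commutation with \<open>t\<close> take the place of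
  \<open>k[[t]]\<close>-linearity. They already determine such an operator from its values on
  constant series, without any continuity argument.\<close>

definition shift_linear :: "('a::ab_group_add fps \<Rightarrow> 'b::ab_group_add fps) \<Rightarrow> bool"
  where "shift_linear D \<longleftrightarrow>
    (\<forall>X Y. D (X + Y) = D X + D Y) \<and> (\<forall>X. D (fps_up X) = fps_up (D X))"

lemma shift_linear_add: "shift_linear D \<Longrightarrow> D (X + Y) = D X + D Y"
  and shift_linear_up: "shift_linear D \<Longrightarrow> D (fps_up X) = fps_up (D X)"
  by (simp_all add: shift_linear_def)

lemma shift_linear_compose: "shift_linear A \<Longrightarrow> shift_linear B \<Longrightarrow> shift_linear (\<lambda>X. A (B X))"
  by (simp add: shift_linear_def)

lemma shift_linear_diff:
  assumes "shift_linear A" "shift_linear B"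
  shows "shift_linear (\<lambda>X. A X - B X)"
proof -
  have "fps_up U - fps_up V = fps_up (U - V)" for U V :: "'b fps"
    by (rule fps_ext, rename_tac n, case_tac n) simp_all
  then show ?thesis using assms by (simp add: shift_linear_def)
qed

text \<open>Splitting off the constant term gives \<open>D X = t * D Y\<close>, where
  \<open>Y\<close> is the shift of \<open>X\<close>. Coefficient \<open>Suc n\<close> of
  \<open>D X\<close> is therefore coefficient \<open>n\<close> of \<open>D Y\<close>, so the
  induction needs \<open>X\<close> arbitrary.\<close>

lemma shift_linear_eq_0:
  assumes D: "shift_linear D" and const: "\<And>x. D (fps_const x) = 0"
  shows "D X = 0"
proof (rule fps_ext)
  have up: "D X = fps_up (D (fps_shift 1 X))" for X
    by (subst fps_const_plus_up[of X], simp only: shift_linear_add[OF D] shift_linear_up[OF D] const)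
      simp
  fix n show "fps_nth (D X) n = fps_nth 0 n"
  proof (induction n arbitrary: X)
    case 0
    show ?case by (subst up) simp
  next
    case (Suc n)
    then show ?case by (subst up) simp
  qed
qed

lemma shift_linear_nth_less:
  assumes D: "shift_linear D" and "\<And>j. j < n \<Longrightarrow> fps_nth X j = 0" and "k < n"
  shows "fps_nth (D X) k = 0"
  using assms(2,3)
proof (induction k arbitrary: X n)
  case 0
  then have "X = fps_up (fps_shift 1 X)" by (intro fps_eq_upI) simp
  then have "D X = fps_up (D (fps_shift 1 X))" using shift_linear_up[OF D] by metis
  then show ?case by simp
next
  case (Suc k)
  then have "X = fps_up (fps_shift 1 X)" by (intro fps_eq_upI) simp
  then have "D X = fps_up (D (fps_shift 1 X))" using shift_linear_up[OF D] by metis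
  moreover have "fps_nth (D (fps_shift 1 X)) k = 0"
    using Suc.prems by (intro Suc.IH[of "n - 1"]) auto
  ultimately show ?case by simp
qed

text \<open>If \<open>X = t^n Y\<close>, then \<open>D X = t^n (D Y)\<close>: the leading
  coefficient of \<open>X\<close> meets only the constant-term action \<open>h\<close> of
  \<open>D\<close>. All later computations at order \<open>n\<close> rest on this.\<close>

lemma shift_linear_nth:
  assumes D: "shift_linear D" and D0: "\<And>X. fps_nth (D X) 0 = h (fps_nth X 0)"
    and "\<And>j. j < n \<Longrightarrow> fps_nth X j = 0"
  shows "fps_nth (D X) n = h (fps_nth X n)"
  using assms(3)
proof (induction n arbitrary: X)
  case 0
  then show ?case by (simp add: D0)
next
  case (Suc n)
  then have "X = fps_up (fps_shift 1 X)" by (intro fps_eq_upI) simp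
  then have "D X = fps_up (D (fps_shift 1 X))" using shift_linear_up[OF D] by metis
  moreover have "fps_nth (D (fps_shift 1 X)) n = h (fps_nth (fps_shift 1 X) n)"
    using Suc.prems by (intro Suc.IH) auto
  ultimately show ?case by simp
qed

section \<open>Linear and alternating trilinear maps\<close>

lemma Hom1I:
  assumes "module s" "\<And>x y. f (x + y) = f x + f y" "\<And>a x. f (s a x) = s a (f x)"
  shows "f \<in> Hom1 s"
  using assms by (simp add: Hom1_def module_hom_def module_hom_axioms_def)

lemma Hom3I:
  assumes "module s"
    "\<And>u v y z. f (u + v) y z = f u y z + f v y z" "\<And>a x y z. f (s a x) y z = s a (f x y z)"
    "\<And>x u v z. f x (u + v) z = f x u z + f x v z" "\<And>a x y z. f x (s a y) z = s a (f x y z)"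
    "\<And>x y u v. f x y (u + v) = f x y u + f x y v" "\<And>a x y z. f x y (s a z) = s a (f x y z)"
    "\<And>x y. f x x y = 0" "\<And>x y. f x y x = 0" "\<And>x y. f y x x = 0"
  shows "f \<in> Hom3 s"
  using assms by (simp add: Hom3_def module_hom_def module_hom_axioms_def)

lemma Hom1_add: "f \<in> Hom1 s \<Longrightarrow> f (x + y) = f x + f y"
  and Hom1_scale: "f \<in> Hom1 s \<Longrightarrow> f (s a x) = s a (f x)"
  and Hom1_0: "f \<in> Hom1 s \<Longrightarrow> f 0 = 0"
  and Hom1_minus: "f \<in> Hom1 s \<Longrightarrow> f (- x) = - f x"
  by (simp_all add: Hom1_def module_hom.add module_hom.scale module_hom.zero module_hom.neg)

lemma Hom3_module_hom:
  assumes "f \<in> Hom3 s"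
  shows "module_hom s s (\<lambda>x. f x y z)" "module_hom s s (\<lambda>y. f x y z)" "module_hom s s (\<lambda>z. f x y z)"
  using assms by (simp_all add: Hom3_def)

lemmas Hom3_add = Hom3_module_hom[THEN module_hom.add]
lemmas Hom3_scale = Hom3_module_hom[THEN module_hom.scale]
lemmas Hom3_0 = Hom3_module_hom[THEN module_hom.zero]
lemmas Hom3_minus = Hom3_module_hom[THEN module_hom.neg]

lemma Hom3_alternating:
  assumes "f \<in> Hom3 s"
  shows "f x x y = 0" "f x y x = 0" "f y x x = 0"
  using assms by (simp_all add: Hom3_def)

text \<open>Polarization: expand the vanishing values at \<open>x + y, x + y\<close> and at
  \<open>y + z, y + z\<close>.\<close>

lemma Hom3_swap:
  assumes f: "f \<in> Hom3 s"
  shows "f y x z = - f x y z" "f x z y = - f x y z"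
proof -
  have "f x y z + f y x z = f (x + y) (x + y) z"
    by (simp only: Hom3_add[OF f]) (simp add: Hom3_alternating[OF f])
  then have "f x y z + f y x z = 0"
    by (simp only: Hom3_alternating[OF f])
  then show "f y x z = - f x y z"
    by (rule minus_unique[symmetric])
  have "f x y z + f x z y = f x (y + z) (y + z)"
    by (simp only: Hom3_add[OF f]) (simp add: Hom3_alternating[OF f])
  then have "f x y z + f x z y = 0"
    by (simp only: Hom3_alternating[OF f])
  then show "f x z y = - f x y z"
    by (rule minus_unique[symmetric])
qed

text \<open>A rotation is a product of two transpositions. It reconciles the cyclically ordered
  arguments in the differentials with the fixed positions in the algebra identities.\<close>

lemma Hom3_cyclic:
  assumes f: "f \<in> Hom3 s"
  shows "f y z x = f x y z" "f z x y = f x y z"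
proof -
  show *: "f y z x = f x y z" for x y z
    using Hom3_swap(2)[OF f, of y x z] Hom3_swap(1)[OF f, of y x z] by simp
  show "f z x y = f x y z"
    by (simp only: *)
qed

section \<open>The power series extensions of families of maps\<close>

lemma ext1_nth: "fps_nth (ext1 f X) n = (\<Sum>i\<le>n. f i (fps_nth X (n - i)))"
  by (simp add: ext1_def)

lemma ext3_nth: "fps_nth (ext3 f X Y Z) n = (\<Sum>i\<le>n. \<Sum>p\<le>n - i. \<Sum>q\<le>n - i - p.
    f i (fps_nth X p) (fps_nth Y q) (fps_nth Z (n - i - p - q)))"
  by (simp add: ext3_def)

lemma shift_linear_ext1:
  assumes f: "\<And>i. f i \<in> Hom1 s"
  shows "shift_linear (ext1 f)"
  unfolding shift_linear_def
proof (intro conjI allI)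
  fix X Y
  show "ext1 f (X + Y) = ext1 f X + ext1 f Y"
    by (rule fps_ext) (simp add: ext1_nth Hom1_add[OF f] sum.distrib)
  show "ext1 f (fps_up X) = fps_up (ext1 f X)"
  proof (rule fps_ext)
    fix n show "fps_nth (ext1 f (fps_up X)) n = fps_nth (fps_up (ext1 f X)) n"
      by (cases n) (auto simp: ext1_nth Hom1_0[OF f] Suc_diff_le intro!: sum.cong)
  qed
qed

text \<open>The second argument of \<open>h\<close> is the degree left for the other factors, so
  \<open>h\<close> may itself be an inner sum of \<open>ext3\<close>. The term \<open>p = 0\<close>
  drops out and the rest is reindexed by one.\<close>

lemma sum_up_left:
  fixes h :: "'a::zero \<Rightarrow> nat \<Rightarrow> 'b::ab_group_add"
  assumes "\<And>j. h 0 j = 0"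
  shows "(\<Sum>p\<le>m. h (fps_nth (fps_up X) p) (m - p)) =
    (case m of 0 \<Rightarrow> 0 | Suc l \<Rightarrow> \<Sum>p\<le>l. h (fps_nth X p) (l - p))"
  by (cases m) (simp_all add: assms sum.atMost_Suc_shift del: sum.atMost_Suc)

text \<open>Moves the case distinction produced by an inner factor \<open>t\<close> to the outer
  degree: of the terms for \<open>n = Suc l\<close>, exactly \<open>p = n\<close> falls into the
  zero case.\<close>

lemma sum_up_right:
  fixes g :: "nat \<Rightarrow> nat \<Rightarrow> 'b::ab_group_add"
  shows "(\<Sum>p\<le>n. case n - p of 0 \<Rightarrow> 0 | Suc l \<Rightarrow> g p l) =
    (case n of 0 \<Rightarrow> 0 | Suc l \<Rightarrow> \<Sum>p\<le>l. g p (l - p))"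
  by (cases n) (auto simp: Suc_diff_le intro!: sum.cong)

lemma sum_up_last:
  fixes h :: "nat \<Rightarrow> 'a::zero \<Rightarrow> 'b::ab_group_add"
  assumes "\<And>j. h j 0 = 0"
  shows "(\<Sum>p\<le>m. h p (fps_nth (fps_up X) (m - p))) =
    (case m of 0 \<Rightarrow> 0 | Suc l \<Rightarrow> \<Sum>p\<le>l. h p (fps_nth X (l - p)))"
  by (cases m) (auto simp: assms Suc_diff_le intro!: sum.cong)

lemma fps_up_ext:
  assumes "\<And>n. fps_nth U n = (case n of 0 \<Rightarrow> 0 | Suc l \<Rightarrow> fps_nth V l)"
  shows "U = fps_up V"
  by (rule fps_ext) (simp add: assms fps_up_def)

lemma shift_linear_ext3:
  assumes f: "\<And>i. f i \<in> Hom3 s"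
  shows "shift_linear (\<lambda>X. ext3 f X Y Z)" (is ?X)
    and "shift_linear (\<lambda>Y. ext3 f X Y Z)" (is ?Y)
    and "shift_linear (\<lambda>Z. ext3 f X Y Z)" (is ?Z)
proof -
  note z = Hom3_0[OF f]
  show ?X unfolding shift_linear_def
  proof (intro conjI allI)
    fix U V
    show "ext3 f (U + V) Y Z = ext3 f U Y Z + ext3 f V Y Z"
      by (rule fps_ext) (simp add: ext3_nth Hom3_add[OF f] sum.distrib)
    show "ext3 f (fps_up U) Y Z = fps_up (ext3 f U Y Z)"
    proof (rule fps_up_ext)
      fix n
      have "(\<Sum>p\<le>m. \<Sum>q\<le>m - p. f i (fps_nth (fps_up U) p) (fps_nth Y q) (fps_nth Z (m - p - q)))
        = (case m of 0 \<Rightarrow> 0 | Suc l \<Rightarrow> \<Sum>p\<le>l. \<Sum>q\<le>l - p. f i (fps_nth U p) (fps_nth Y q) (fps_nth Z (l - p - q)))"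
        for i m
        by (rule sum_up_left[where h = "\<lambda>x j. \<Sum>q\<le>j. f i x (fps_nth Y q) (fps_nth Z (j - q))"])
          (simp add: z)
      then show "fps_nth (ext3 f (fps_up U) Y Z) n = (case n of 0 \<Rightarrow> 0 | Suc l \<Rightarrow> fps_nth (ext3 f U Y Z) l)"
        by (simp only: ext3_nth sum_up_right)
    qed
  qed
  show ?Y unfolding shift_linear_def
  proof (intro conjI allI)
    fix U V
    show "ext3 f X (U + V) Z = ext3 f X U Z + ext3 f X V Z"
      by (rule fps_ext) (simp add: ext3_nth Hom3_add[OF f] sum.distrib)
    show "ext3 f X (fps_up U) Z = fps_up (ext3 f X U Z)"
    proof (rule fps_up_ext)
      fix n
      have "(\<Sum>q\<le>m. f i x (fps_nth (fps_up U) q) (fps_nth Z (m - q)))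
        = (case m of 0 \<Rightarrow> 0 | Suc l \<Rightarrow> \<Sum>q\<le>l. f i x (fps_nth U q) (fps_nth Z (l - q)))"
        for i x m
        by (rule sum_up_left[where h = "\<lambda>y j. f i x y (fps_nth Z j)"]) (simp add: z)
      then show "fps_nth (ext3 f X (fps_up U) Z) n = (case n of 0 \<Rightarrow> 0 | Suc l \<Rightarrow> fps_nth (ext3 f X U Z) l)"
        by (simp only: ext3_nth sum_up_right)
    qed
  qed
  show ?Z unfolding shift_linear_def
  proof (intro conjI allI)
    fix U V
    show "ext3 f X Y (U + V) = ext3 f X Y U + ext3 f X Y V"
      by (rule fps_ext) (simp add: ext3_nth Hom3_add[OF f] sum.distrib)
    show "ext3 f X Y (fps_up U) = fps_up (ext3 f X Y U)"
    proof (rule fps_up_ext)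
      fix n
      have "(\<Sum>q\<le>m. f i x (fps_nth Y q) (fps_nth (fps_up U) (m - q)))
        = (case m of 0 \<Rightarrow> 0 | Suc l \<Rightarrow> \<Sum>q\<le>l. f i x (fps_nth Y q) (fps_nth U (l - q)))"
        for i x m
        by (rule sum_up_last[where h = "\<lambda>q. f i x (fps_nth Y q)"]) (simp add: z)
      then show "fps_nth (ext3 f X Y (fps_up U)) n = (case n of 0 \<Rightarrow> 0 | Suc l \<Rightarrow> fps_nth (ext3 f X Y U) l)"
        by (simp only: ext3_nth sum_up_right)
    qed
  qed
qed

text \<open>At the order \<open>n\<close> to which one argument vanishes, only \<open>f 0\<close>
  and the constant terms of the other two arguments can contribute. This is
  \<open>shift_linear_nth\<close> in each slot.\<close>

lemma ext3_nth_order: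
  assumes f: "\<And>i. f i \<in> Hom3 s" and W: "\<And>j. j < n \<Longrightarrow> fps_nth W j = 0"
  shows "fps_nth (ext3 f W Y Z) n = f 0 (fps_nth W n) (fps_nth Y 0) (fps_nth Z 0)"
    and "fps_nth (ext3 f X W Z) n = f 0 (fps_nth X 0) (fps_nth W n) (fps_nth Z 0)"
    and "fps_nth (ext3 f X Y W) n = f 0 (fps_nth X 0) (fps_nth Y 0) (fps_nth W n)"
    and "k < n \<Longrightarrow> fps_nth (ext3 f W Y Z) k = 0"
    and "k < n \<Longrightarrow> fps_nth (ext3 f X W Z) k = 0"
    and "k < n \<Longrightarrow> fps_nth (ext3 f X Y W) k = 0"
proof -
  note L = shift_linear_ext3[OF f]
  show "fps_nth (ext3 f W Y Z) n = f 0 (fps_nth W n) (fps_nth Y 0) (fps_nth Z 0)"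
    by (rule shift_linear_nth[OF L(1), where h = "\<lambda>x. f 0 x (fps_nth Y 0) (fps_nth Z 0)"])
      (simp_all add: ext3_nth W)
  show "fps_nth (ext3 f X W Z) n = f 0 (fps_nth X 0) (fps_nth W n) (fps_nth Z 0)"
    by (rule shift_linear_nth[OF L(2), where h = "\<lambda>y. f 0 (fps_nth X 0) y (fps_nth Z 0)"])
      (simp_all add: ext3_nth W)
  show "fps_nth (ext3 f X Y W) n = f 0 (fps_nth X 0) (fps_nth Y 0) (fps_nth W n)"
    by (rule shift_linear_nth[OF L(3), where h = "f 0 (fps_nth X 0) (fps_nth Y 0)"])
      (simp_all add: ext3_nth W)
  show "k < n \<Longrightarrow> fps_nth (ext3 f W Y Z) k = 0"
    and "k < n \<Longrightarrow> fps_nth (ext3 f X W Z) k = 0"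
    and "k < n \<Longrightarrow> fps_nth (ext3 f X Y W) k = 0"
    using L[THEN shift_linear_nth_less, of n W k] W by auto
qed

lemma ext1_nth_order:
  assumes f: "\<And>i. f i \<in> Hom1 s" and W: "\<And>j. j < n \<Longrightarrow> fps_nth W j = 0"
  shows "fps_nth (ext1 f W) n = f 0 (fps_nth W n)"
    and "k < n \<Longrightarrow> fps_nth (ext1 f W) k = 0"
proof -
  note L = shift_linear_ext1[OF f]
  show "fps_nth (ext1 f W) n = f 0 (fps_nth W n)"
    by (rule shift_linear_nth[OF L]) (simp_all add: ext1_nth W)
  show "k < n \<Longrightarrow> fps_nth (ext1 f W) k = 0"
    using L[THEN shift_linear_nth_less, of n W k] W by auto
qed

lemma ext1_nth_cong:
  "(\<And>j. j \<le> n \<Longrightarrow> fps_nth X j = fps_nth X' j) \<Longrightarrow> fps_nth (ext1 f X) n = fps_nth (ext1 f X') n"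
  by (simp add: ext1_nth)

lemma ext3_nth_cong:
  assumes "\<And>j. j \<le> n \<Longrightarrow> fps_nth X j = fps_nth X' j" "\<And>j. j \<le> n \<Longrightarrow> fps_nth Y j = fps_nth Y' j"
    "\<And>j. j \<le> n \<Longrightarrow> fps_nth Z j = fps_nth Z' j"
  shows "fps_nth (ext3 f X Y Z) n = fps_nth (ext3 f X' Y' Z') n"
  unfolding ext3_nth by (intro sum.cong refl) (simp add: assms)

section \<open>Values on constant series\<close>

lemma ext1_const:
  assumes "\<And>i. f i \<in> Hom1 s"
  shows "ext1 f (fps_const x) = Abs_fps (\<lambda>i. f i x)"
proof (rule fps_ext)
  fix n
  have "(\<Sum>i\<le>n. f i (fps_nth (fps_const x) (n - i))) = (\<Sum>i\<le>n. if i = n then f i x else 0)"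
    by (intro sum.cong) (auto simp: Hom1_0[OF assms])
  then show "fps_nth (ext1 f (fps_const x)) n = fps_nth (Abs_fps (\<lambda>i. f i x)) n"
    by (simp add: ext1_nth)
qed

lemma ext1_const_series:
  "ext1 (const_series f) (fps_const x) = fps_const (f x)" if "f 0 = 0"
proof (rule fps_ext)
  fix n
  have "(\<Sum>i\<le>n. const_series f i (fps_nth (fps_const x) (n - i)))
      = (\<Sum>i\<le>n. if i = 0 then f (fps_nth (fps_const x) n) else 0)"
    by (intro sum.cong) (auto simp: const_series_def)
  then show "fps_nth (ext1 (const_series f) (fps_const x)) n = fps_nth (fps_const (f x)) n"
    by (simp add: ext1_nth that)
qed

lemma ext3_const_series:
  assumes f: "f \<in> Hom3 s"
  shows "ext3 (const_series f) (fps_const x) (fps_const y) (fps_const z) = fps_const (f x y z)"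
proof (rule fps_ext)
  fix n
  note z = Hom3_0[OF f]
  show "fps_nth (ext3 (const_series f) (fps_const x) (fps_const y) (fps_const z)) n =
    fps_nth (fps_const (f x y z)) n"
  proof (cases "n = 0")
    case True
    then show ?thesis by (simp add: ext3_nth const_series_def)
  next
    case False
    have "const_series f i (fps_nth (fps_const x) p) (fps_nth (fps_const y) q)
        (fps_nth (fps_const z) (n - i - p - q)) = 0" for i p q
      using False by (auto simp: const_series_def z)
    then show ?thesis using False by (simp add: ext3_nth)
  qed
qed

lemma fps_scale_const_nth:
  assumes "module s"
  shows "fps_nth (fps_scale s (fps_const a) V) n = s a (fps_nth V n)"
proof -
  interpret module s by fact
  have "(\<Sum>i\<le>n. s (fps_nth (fps_const a) i) (fps_nth V (n - i))) =
      (\<Sum>i\<le>n. if i = 0 then s a (fps_nth V n) else 0)"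
    by (intro sum.cong) auto
  then show ?thesis by (simp add: fps_scale_def)
qed

section \<open>Vanishing of the second cohomology group\<close>

lemma coboundary_if_trivial_cohomology2:
  assumes rb: "rota_baxter_lie3_algebra s mu lam T"
    and trivial: "trivial_group (cohomology2 s mu lam T)"
    and c: "c \<in> cocycles2 s mu lam T"
  shows "c \<in> coboundaries2 s mu T"
proof -
  interpret rota_baxter_lie3_algebra s mu lam T by fact
  let ?B = "coboundaries2 s mu T"
  let ?G = "\<lparr>carrier = cocycles2 s mu lam T, monoid.mult = (+), one = 0\<rparr>"
  have "(\<lambda>x. 0) \<in> Hom1 s"
    by (intro Hom1I) (simp_all add: module_axioms)
  moreover have "d1 mu T (\<lambda>x. 0, 0) = 0"
    by (simp add: d1_def delta1_def partial0_def Phi1_def rho_def fun_eq_iff zero_prod_def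
        Hom3_0[OF br_Hom3] Hom1_0[OF T_Hom1])
  ultimately have "0 \<in> ?B"
    unfolding coboundaries2_def cochains1_def by force
  \<comment> \<open>The quotient has \<open>?B\<close> as its only element, so the coset of
    \<open>c\<close> is \<open>?B\<close>; this coset contains \<open>c\<close> because
    \<open>0\<close> is a coboundary.\<close>
  moreover have "?B #>\<^bsub>?G\<^esub> c \<in> carrier (?G Mod ?B)"
    using c by (simp add: carrier_FactGroup)
  then have "?B #>\<^bsub>?G\<^esub> c = ?B"
    using trivial by (simp add: trivial_group_def cohomology2_def)
  ultimately show ?thesis
    by (force simp: r_coset_def)
qed

section \<open>Obstructions\<close>

text \<open>For linear coefficients this is \<open>ext1 psi (fps_const x)\<close>. It lets the
  intertwining conditions be studied on elements of the algebra instead of on all power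
  series.\<close>

definition fps_app :: "(nat \<Rightarrow> 'a \<Rightarrow> 'b) \<Rightarrow> 'a \<Rightarrow> 'b fps"
  where "fps_app psi x = Abs_fps (\<lambda>n. psi n x)"

lemma fps_app_nth [simp]: "fps_nth (fps_app psi x) n = psi n x"
  by (simp add: fps_app_def)

locale deformation_of_rota_baxter = rota_baxter_lie3_algebra scale mu lam T
  for scale :: "'k::field \<Rightarrow> 'g::ab_group_add \<Rightarrow> 'g" and mu lam T +
  fixes mu_t :: "nat \<Rightarrow> 'g \<Rightarrow> 'g \<Rightarrow> 'g \<Rightarrow> 'g" and T_t :: "nat \<Rightarrow> 'g \<Rightarrow> 'g"
  assumes deformation: "formal_deformation scale mu lam T mu_t T_t"
begin

abbreviation M :: "'g fps \<Rightarrow> 'g fps \<Rightarrow> 'g fps \<Rightarrow> 'g fps" where "M \<equiv> ext3 mu_t"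
abbreviation TT :: "'g fps \<Rightarrow> 'g fps" where "TT \<equiv> ext1 T_t"

lemma mu_t_Hom3: "mu_t i \<in> Hom3 scale" and T_t_Hom1: "T_t i \<in> Hom1 scale"
  and mu_t_0: "mu_t 0 = mu" and T_t_0: "T_t 0 = T"
  using deformation by (simp_all add: formal_deformation_def)

sublocale formal: rota_baxter_lie3_algebra "fps_scale scale" M "fps_const lam" TT
  using deformation by (simp add: formal_deformation_def)

lemmas M_add = Hom3_add[OF formal.br_Hom3]
lemmas TT_add = Hom1_add[OF formal.T_Hom1]
lemmas mu_add = Hom3_add[OF br_Hom3]
lemmas T_add = Hom1_add[OF T_Hom1]
lemmas M_order = ext3_nth_order[where f = mu_t, OF mu_t_Hom3, unfolded mu_t_0]
lemmas TT_order = ext1_nth_order[where f = T_t, OF T_t_Hom1, unfolded T_t_0]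

lemma TT_nth_0: "fps_nth (TT X) 0 = T (fps_nth X 0)"
  by (simp add: ext1_nth T_t_0)

lemma M_nth_0: "fps_nth (M X Y Z) 0 = mu (fps_nth X 0) (fps_nth Y 0) (fps_nth Z 0)"
  by (simp add: ext3_nth mu_t_0)

text \<open>The two defects measure how far \<open>\<Sum>\<^sub>i psi i t\<^sup>i\<close> is from intertwining the constant
  deformation with the given one.\<close>

definition defect3 :: "(nat \<Rightarrow> 'g \<Rightarrow> 'g) \<Rightarrow> 'g \<Rightarrow> 'g \<Rightarrow> 'g \<Rightarrow> 'g fps"
  where "defect3 psi x y z = M (fps_app psi x) (fps_app psi y) (fps_app psi z) - fps_app psi (mu x y z)"

definition defect1 :: "(nat \<Rightarrow> 'g \<Rightarrow> 'g) \<Rightarrow> 'g \<Rightarrow> 'g fps"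
  where "defect1 psi x = TT (fps_app psi x) - fps_app psi (T x)"

lemma M_fps_app: "M (fps_app psi x) (fps_app psi y) (fps_app psi z) = defect3 psi x y z + fps_app psi (mu x y z)"
  by (simp add: defect3_def)

lemma TT_fps_app: "TT (fps_app psi x) = defect1 psi x + fps_app psi (T x)"
  by (simp add: defect1_def)

section \<open>Leading coefficients of defects that vanish below order \<open>n\<close>\<close>

context
  fixes psi :: "nat \<Rightarrow> 'g \<Rightarrow> 'g" and n :: nat
  assumes psi: "\<And>i. psi i \<in> Hom1 scale" and psi_0: "psi 0 = id"
    and ord3: "\<And>k x y z. k < n \<Longrightarrow> fps_nth (defect3 psi x y z) k = 0"
    and ord1: "\<And>k x. k < n \<Longrightarrow> fps_nth (defect1 psi x) k = 0"
begin

lemma fps_app_add: "fps_app psi (x + y) = fps_app psi x + fps_app psi y"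
  by (rule fps_ext) (simp add: Hom1_add[OF psi])

lemma fps_app_scale: "fps_app psi (scale a x) = fps_scale scale (fps_const a) (fps_app psi x)"
  by (rule fps_ext) (simp add: Hom1_scale[OF psi] fps_scale_const_nth[OF module_axioms])

lemma defect3_Hom3: "(\<lambda>x y z. fps_nth (defect3 psi x y z) n) \<in> Hom3 scale"
proof -
  note [simp] = defect3_def fps_app_add fps_app_scale M_add mu_add Hom1_add[OF psi] Hom1_scale[OF psi]
    Hom3_scale[OF br_Hom3] Hom3_scale[OF formal.br_Hom3] fps_scale_const_nth[OF module_axioms]
    scale_right_diff_distrib Hom3_alternating[OF br_Hom3] Hom3_alternating[OF formal.br_Hom3]
    Hom1_0[OF psi]
  show ?thesis
    by (intro Hom3I module_axioms) simp_all
qed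

lemma defect1_Hom1: "(\<lambda>x. fps_nth (defect1 psi x) n) \<in> Hom1 scale"
proof -
  note [simp] = defect1_def fps_app_add fps_app_scale TT_add T_add Hom1_add[OF psi] Hom1_scale[OF psi]
    Hom1_scale[OF T_Hom1] Hom1_scale[OF formal.T_Hom1] fps_scale_const_nth[OF module_axioms]
    scale_right_diff_distrib
  show ?thesis
    by (intro Hom1I module_axioms) simp_all
qed

section \<open>The fundamental identity at order \<open>n\<close>\<close>

text \<open>The inner bracket is split into its defect and \<open>fps_app psi\<close> of a bracket.
  The defect has order at least \<open>n\<close>, so it meets only \<open>mu\<close> and the
  constant terms given by \<open>psi 0 = id\<close>; the other summand is again a bracket of series
  \<open>fps_app psi\<close>, with its own defect.\<close>

lemma M_nested_nth:
  "fps_nth (M (fps_app psi x) (fps_app psi y) (M (fps_app psi u) (fps_app psi v) (fps_app psi w))) n =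
    mu x y (fps_nth (defect3 psi u v w) n) + fps_nth (defect3 psi x y (mu u v w)) n
      + psi n (mu x y (mu u v w))"
  "fps_nth (M (fps_app psi x) (M (fps_app psi u) (fps_app psi v) (fps_app psi w)) (fps_app psi z)) n =
    mu x (fps_nth (defect3 psi u v w) n) z + fps_nth (defect3 psi x (mu u v w) z) n
      + psi n (mu x (mu u v w) z)"
  "fps_nth (M (M (fps_app psi u) (fps_app psi v) (fps_app psi w)) (fps_app psi y) (fps_app psi z)) n =
    mu (fps_nth (defect3 psi u v w) n) y z + fps_nth (defect3 psi (mu u v w) y z) n
      + psi n (mu (mu u v w) y z)"
  by (simp_all add: M_fps_app[of psi u v w] M_add M_order ord3 psi_0 add.assoc)
    (simp_all add: M_fps_app)

lemma delta2_defect3: "delta2 mu (\<lambda>x y z. fps_nth (defect3 psi x y z) n) x1 x2 x3 x4 x5 = 0"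
proof -
  let ?E = "\<lambda>x y z. fps_nth (defect3 psi x y z) n"
  have "mu x1 x2 (?E x3 x4 x5) + ?E x1 x2 (mu x3 x4 x5) + psi n (mu x1 x2 (mu x3 x4 x5)) =
      (mu (?E x1 x2 x3) x4 x5 + ?E (mu x1 x2 x3) x4 x5 + psi n (mu (mu x1 x2 x3) x4 x5))
    + (mu x3 (?E x1 x2 x4) x5 + ?E x3 (mu x1 x2 x4) x5 + psi n (mu x3 (mu x1 x2 x4) x5))
    + (mu x3 x4 (?E x1 x2 x5) + ?E x3 x4 (mu x1 x2 x5) + psi n (mu x3 x4 (mu x1 x2 x5)))"
    using arg_cong[OF formal.fundamental_identity[of "fps_app psi x1" "fps_app psi x2" "fps_app psi x3"
        "fps_app psi x4" "fps_app psi x5"], of "\<lambda>V. fps_nth V n"]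
    by (simp only: M_nested_nth fps_add_nth)
  \<comment> \<open>The terms containing \<open>psi n\<close> cancel by the fundamental identity of
    \<open>mu\<close> itself.\<close>
  moreover have "psi n (mu x1 x2 (mu x3 x4 x5)) = psi n (mu (mu x1 x2 x3) x4 x5)
      + psi n (mu x3 (mu x1 x2 x4) x5) + psi n (mu x3 x4 (mu x1 x2 x5))"
    by (simp only: fundamental_identity[of x1 x2 x3 x4 x5] Hom1_add[OF psi])
  moreover have "mu x4 x5 (?E x1 x2 x3) = mu (?E x1 x2 x3) x4 x5"
    "mu x5 x3 (?E x1 x2 x4) = mu x3 (?E x1 x2 x4) x5"
    using Hom3_cyclic[OF br_Hom3] by metis+
  ultimately show ?thesis
    by (simp add: delta2_def rho_def algebra_simps)
qed

section \<open>The Rota-Baxter identity at order \<open>n\<close>\<close>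

text \<open>This also covers \<open>n = 0\<close>, where \<open>ord1\<close> says nothing. It makes
  every bracket containing two defects vanish at order \<open>n\<close>.\<close>

lemma defect1_nth_0: "fps_nth (defect1 psi x) 0 = 0"
  by (simp add: defect1_def TT_nth_0 psi_0)

text \<open>Expanding \<open>TT\<close> as defect plus \<open>fps_app psi\<close> gives eight
  brackets: one without \<open>defect1\<close>, three with exactly one, and four with at least two,
  which vanish at order \<open>n\<close>.\<close>

lemma M_TT_nth:
  "fps_nth (M (TT (fps_app psi x)) (TT (fps_app psi y)) (TT (fps_app psi z))) n =
    mu (fps_nth (defect1 psi x) n) (T y) (T z) + mu (T x) (fps_nth (defect1 psi y) n) (T z)
    + mu (T x) (T y) (fps_nth (defect1 psi z) n)
    + fps_nth (defect3 psi (T x) (T y) (T z)) n + psi n (mu (T x) (T y) (T z))"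
  by (simp add: TT_fps_app M_add M_order ord1 psi_0 defect1_nth_0 M_fps_app Hom3_0[OF br_Hom3])

text \<open>Below order \<open>n\<close> no defect is visible, so \<open>psi\<close> respects the
  deformed bracket. This supplies the vanishing order needed before \<open>TT\<close> can be applied
  to the difference.\<close>

lemma br_T_nth_less:
  assumes "k < n"
  shows "fps_nth (br_T (fps_scale scale) (fps_const lam) M TT (fps_app psi x) (fps_app psi y) (fps_app psi z)) k =
    psi k (br_T scale lam mu T x y z)"
  using assms
  by (simp add: br_T_def TT_fps_app M_add M_order ord1 ord3 psi_0 defect1_nth_0 M_fps_app
      Hom3_0[OF br_Hom3] fps_scale_const_nth[OF module_axioms] Hom1_add[OF psi] Hom1_scale[OF psi])

text \<open>Each occurrence of \<open>T\<close> in a summand of \<open>br_T\<close> contributes one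
  replacement of \<open>T\<close> by the leading coefficient of \<open>defect1\<close>: two for each
  bracket with two \<open>T\<close>, one for each bracket with a single \<open>T\<close>, none for
  the last.\<close>

lemma br_T_nth:
  "fps_nth (br_T (fps_scale scale) (fps_const lam) M TT (fps_app psi x) (fps_app psi y) (fps_app psi z)) n =
    psi n (br_T scale lam mu T x y z)
    + br_T scale lam (\<lambda>x y z. fps_nth (defect3 psi x y z) n) T x y z
    + (mu (fps_nth (defect1 psi x) n) (T y) z + mu (T x) (fps_nth (defect1 psi y) n) z)
    + (mu (fps_nth (defect1 psi x) n) y (T z) + mu (T x) y (fps_nth (defect1 psi z) n))
    + (mu x (fps_nth (defect1 psi y) n) (T z) + mu x (T y) (fps_nth (defect1 psi z) n))
    + scale lam (mu (fps_nth (defect1 psi x) n) y z) + scale lam (mu x (fps_nth (defect1 psi y) n) z)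
    + scale lam (mu x y (fps_nth (defect1 psi z) n))"
  by (simp add: br_T_def TT_fps_app M_add M_order ord1 psi_0 defect1_nth_0 M_fps_app
      Hom3_0[OF br_Hom3] fps_scale_const_nth[OF module_axioms] Hom1_add[OF psi] Hom1_scale[OF psi]
      scale_right_distrib algebra_simps)

lemma partial1_Phi2_defect:
  "partial1 scale mu lam T (\<lambda>x. fps_nth (defect1 psi x) n) x y z
    + Phi2 scale lam T (\<lambda>x y z. fps_nth (defect3 psi x y z) n) x y z = 0"
proof -
  define E where "E = (\<lambda>x y z. fps_nth (defect3 psi x y z) n)"
  define F where "F = (\<lambda>x. fps_nth (defect1 psi x) n)"
  define b where "b = br_T scale lam mu T x y z"
  define R where "R = br_T (fps_scale scale) (fps_const lam) M TT (fps_app psi x) (fps_app psi y) (fps_app psi z)"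
  \<comment> \<open>The leading coefficient of \<open>R - fps_app psi b\<close>, as computed in
    \<open>br_T_nth\<close>.\<close>
  define w where "w = br_T scale lam E T x y z
    + (mu (F x) (T y) z + mu (T x) (F y) z) + (mu (F x) y (T z) + mu (T x) y (F z))
    + (mu x (F y) (T z) + mu x (T y) (F z))
    + scale lam (mu (F x) y z) + scale lam (mu x (F y) z) + scale lam (mu x y (F z))"
  have W: "fps_nth (R - fps_app psi b) k = 0" if "k < n" for k
    using that by (simp add: R_def b_def br_T_nth_less)
  have "fps_nth (R - fps_app psi b) n = w"
    by (simp add: R_def b_def br_T_nth w_def E_def F_def)
  \<comment> \<open>The remainder \<open>R - fps_app psi b\<close> has order at least
    \<open>n\<close>, so at order \<open>n\<close> the operator \<open>TT\<close> acts on it as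
    \<open>T\<close>.\<close>
  moreover have "TT R = TT (fps_app psi b) + TT (R - fps_app psi b)"
    by (simp flip: TT_add)
  ultimately have "fps_nth (TT R) n = F b + psi n (T b) + T w"
    using W by (simp add: TT_order TT_fps_app F_def)
  \<comment> \<open>The other side of the Rota-Baxter identity. Since \<open>T b\<close> is
    \<open>mu (T x) (T y) (T z)\<close>, the same term \<open>psi n (T b)\<close> occurs on both
    sides and cancels.\<close>
  moreover have "fps_nth (TT R) n = mu (F x) (T y) (T z) + mu (T x) (F y) (T z)
    + mu (T x) (T y) (F z) + E (T x) (T y) (T z) + psi n (T b)"
    unfolding R_def formal.rota_baxter[symmetric] M_TT_nth
    by (simp add: E_def F_def b_def rota_baxter)
  ultimately have *: "mu (F x) (T y) (T z) + mu (T x) (F y) (T z)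
    + mu (T x) (T y) (F z) + E (T x) (T y) (T z) = F b + T w"
    by (simp add: add.commute add.left_commute)
  have cyc: "mu (F a) u v = mu u v (F a)" "mu u (F a) v = mu v u (F a)" for a u v
    using Hom3_cyclic[OF br_Hom3] by metis+
  show ?thesis
    using * unfolding E_def[symmetric] F_def[symmetric] partial1_def Phi2_def rho_T_def b_def w_def
    by (simp add: cyc T_add Hom1_scale[OF T_Hom1] algebra_simps)
qed

lemma defects_cocycle:
  "(\<lambda>x y z. fps_nth (defect3 psi x y z) n, \<lambda>x. fps_nth (defect1 psi x) n)
    \<in> cocycles2 scale mu lam T"
proof -
  have "- partial1 scale mu lam T (\<lambda>x. fps_nth (defect1 psi x) n) x y z
    - Phi2 scale lam T (\<lambda>x y z. fps_nth (defect3 psi x y z) n) x y z = 0" for x y z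
    unfolding minus_add_distrib[symmetric] diff_conv_add_uminus partial1_Phi2_defect by simp
  then show ?thesis
    by (simp add: cocycles2_def cochains2_def defect3_Hom3 defect1_Hom1 d2_def zero_prod_def
        fun_eq_iff delta2_defect3)
qed

text \<open>As \<open>psi n\<close> is zero, the update adds \<open>r t^n\<close>. For
  \<open>0 < n\<close> products of two such corrections start beyond order \<open>n\<close>, so the
  change is linear in \<open>r\<close>: it is \<open>d1\<close> of \<open>(r, 0)\<close>.\<close>

lemma defect_add_top:
  assumes n: "0 < n" and psi_n: "\<And>x. psi n x = 0" and r: "r \<in> Hom1 scale"
  shows "fps_nth (defect3 (psi(n := r)) x y z) n = fps_nth (defect3 psi x y z) n + delta1 mu r x y z"
    and "fps_nth (defect1 (psi(n := r)) x) n = fps_nth (defect1 psi x) n - Phi1 T r x"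
proof -
  define top where "top x = Abs_fps (\<lambda>i. if i = n then r x else 0)" for x
  have fps_app: "fps_app (psi(n := r)) x = fps_app psi x + top x" for x
    by (rule fps_ext) (simp add: top_def psi_n)
  have top: "fps_nth (top x) n = r x" "j < n \<Longrightarrow> fps_nth (top x) j = 0" "fps_nth (top x) 0 = 0" for x j
    using n by (simp_all add: top_def)
  have cyc: "mu (r a) u v = mu u v (r a)" "mu u (r a) v = mu v u (r a)" for a u v
    using Hom3_cyclic[OF br_Hom3] by metis+
  show "fps_nth (defect3 (psi(n := r)) x y z) n = fps_nth (defect3 psi x y z) n + delta1 mu r x y z"
    by (simp add: defect3_def fps_app M_add M_order top psi_0 Hom3_0[OF br_Hom3] psi_n delta1_def rho_def cyc)
  show "fps_nth (defect1 (psi(n := r)) x) n = fps_nth (defect1 psi x) n - Phi1 T r x"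
    by (simp add: defect1_def fps_app TT_add TT_order top psi_n Phi1_def)
qed

end

section \<open>Recursive construction of the intertwiner\<close>

text \<open>Coefficient \<open>n\<close> of a convolution sees only indices up to \<open>n\<close>;
  hence the condition on the next coefficient of \<open>psi\<close> depends only on the earlier
  ones.\<close>

lemma defect_nth_cong:
  assumes "\<And>i. i \<le> n \<Longrightarrow> psi i = psi' i"
  shows "fps_nth (defect3 psi x y z) n = fps_nth (defect3 psi' x y z) n"
    and "fps_nth (defect1 psi x) n = fps_nth (defect1 psi' x) n"
proof -
  show "fps_nth (defect3 psi x y z) n = fps_nth (defect3 psi' x y z) n"
    unfolding defect3_def fps_sub_nth using assms
    by (intro arg_cong2[of _ _ _ _ "(-)"] ext3_nth_cong) simp_all
  show "fps_nth (defect1 psi x) n = fps_nth (defect1 psi' x) n"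
    unfolding defect1_def fps_sub_nth using assms
    by (intro arg_cong2[of _ _ _ _ "(-)"] ext1_nth_cong) simp_all
qed

lemma intertwiner_exists:
  assumes cohomology: "cocycles2 scale mu lam T \<subseteq> coboundaries2 scale mu T"
  obtains psi where "\<And>i. psi i \<in> Hom1 scale" "psi 0 = id"
    "\<And>x y z. defect3 psi x y z = 0" "\<And>x. defect1 psi x = 0"
proof -
  \<comment> \<open>\<open>r\<close> is an admissible coefficient of \<open>t^n\<close> after those
    of \<open>psi\<close> below \<open>n\<close>; the entries above \<open>n\<close> do not
    influence the condition.\<close>
  define P where "P psi n r \<longleftrightarrow> r \<in> Hom1 scale \<and> (n = 0 \<longrightarrow> r = id) \<and>
    (\<forall>x y z. fps_nth (defect3 (psi(n := r)) x y z) n = 0) \<and>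
    (\<forall>x. fps_nth (defect1 (psi(n := r)) x) n = 0)" for psi and n :: nat and r
  have "\<exists>psi. \<forall>n. P psi n (psi n)"
  \<comment> \<open>Choice along a well-founded order: the condition at \<open>n\<close> must depend
    only on values below \<open>n\<close>, and it must be satisfiable once those values are
    admissible.\<close>
  proof (rule dependent_wf_choice[OF wf_less_than])
    fix f g :: "nat \<Rightarrow> 'g \<Rightarrow> 'g" and n r
    assume "\<And>z. (z, n) \<in> less_than \<Longrightarrow> f z = g z"
    then have eq: "(f(n := r)) i = (g(n := r)) i" if "i \<le> n" for i
      using that by (cases "i = n") auto
    show "P f n r = P g n r"
      by (simp add: P_def defect_nth_cong[of n "f(n := r)" "g(n := r)", OF eq])
  next
    fix n f assume "\<And>m. (m, n) \<in> less_than \<Longrightarrow> P f m (f m)"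
    then have IH: "P f m (f m)" if "m < n" for m using that by simp
    have id: "id \<in> Hom1 scale" and zero: "(\<lambda>x. 0) \<in> Hom1 scale"
      by (intro Hom1I module_axioms; simp)+
    show "\<exists>r. P f n r"
    proof (cases "n = 0")
      case True
      have "P f n id"
        using id True by (simp add: P_def defect3_def defect1_def M_nth_0 TT_nth_0)
      then show ?thesis by (intro exI[of _ id])
    next
      case False
      \<comment> \<open>The values of \<open>f\<close> from \<open>n\<close> on are arbitrary.
        Truncating by zero makes all coefficients linear and gives the zero at \<open>n\<close> that
        \<open>defect_add_top\<close> requires.\<close>
      define psi where "psi i = (if i < n then f i else (\<lambda>x. 0))" for i
      have psi: "psi i \<in> Hom1 scale" for i
        using IH[of i] zero by (simp add: psi_def P_def)
      have psi_0: "psi 0 = id"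
        using IH[of 0] False by (simp add: psi_def P_def)
      have psi_f: "psi i = f i" if "i \<le> k" "k < n" for i k
        using that by (simp add: psi_def)
      have ord: "fps_nth (defect3 psi x y z) k = 0" "fps_nth (defect1 psi x) k = 0"
        if "k < n" for k x y z
        using IH[OF that] by (simp_all add: P_def defect_nth_cong[of k psi f, OF psi_f[OF _ that]])
      obtain h a where h: "h \<in> Hom1 scale"
        "(\<lambda>x y z. fps_nth (defect3 psi x y z) n, \<lambda>x. fps_nth (defect1 psi x) n) = d1 mu T (h, a)"
        using subsetD[OF cohomology defects_cocycle[OF psi psi_0 ord]]
        unfolding coboundaries2_def cochains1_def by blast
      then have E: "fps_nth (defect3 psi x y z) n = delta1 mu h x y z"
        and F: "fps_nth (defect1 psi x) n = - Phi1 T h x" for x y z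
        by (auto simp: d1_def partial0_def fun_eq_iff)
      \<comment> \<open>With \<open>d1\<close> of \<open>(h, a)\<close> equal to the pair of leading
        defects, the sign makes the change of that pair cancel it exactly.\<close>
      define r where "r x = - h x" for x
      have r: "r \<in> Hom1 scale"
        by (intro Hom1I module_axioms) (simp_all add: r_def Hom1_add[OF h(1)] Hom1_scale[OF h(1)])
      have "delta1 mu r x y z = - delta1 mu h x y z" "Phi1 T r x = - Phi1 T h x" for x y z
        by (simp_all add: delta1_def Phi1_def rho_def r_def Hom3_minus[OF br_Hom3] Hom1_minus[OF T_Hom1])
      moreover have "psi n x = 0" for x by (simp add: psi_def)
      moreover have "(f(n := r)) i = (psi(n := r)) i" if "i \<le> n" for i
        using that by (simp add: psi_def)
      ultimately have "P f n r"
        using False r by (simp add: P_def defect_nth_cong[of n "f(n := r)" "psi(n := r)"]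
            defect_add_top[OF psi psi_0 ord] E F)
      then show ?thesis by (intro exI[of _ r])
    qed
  qed
  then obtain psi where psi: "\<And>n. P psi n (psi n)" by blast
  show ?thesis
  proof
    show "psi i \<in> Hom1 scale" "psi 0 = id" for i
      using psi by (simp_all add: P_def)
    show "defect3 psi x y z = 0" "defect1 psi x = 0" for x y z
      by (rule fps_ext, use psi in \<open>simp add: P_def\<close>)+
  qed
qed

section \<open>From constants to all power series\<close>

lemma trivial_if_intertwiner:
  assumes psi: "\<And>i. psi i \<in> Hom1 scale" and psi_0: "psi 0 = id"
    and defect: "\<And>x y z. defect3 psi x y z = 0" "\<And>x. defect1 psi x = 0"
  shows "trivial_deformation scale mu T mu_t T_t"
proof -
  have fps_app: "ext1 psi (fps_const x) = fps_app psi x" for x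
    by (simp add: ext1_const[OF psi] fps_app_def)
  have "(\<lambda>x. 0) \<in> Hom1 scale" "(\<lambda>x y z. 0) \<in> Hom3 scale"
    by (auto intro!: Hom1I Hom3I module_axioms)
  then have const: "const_series T i \<in> Hom1 scale" "const_series mu i \<in> Hom3 scale" for i
    by (auto simp: const_series_def T_Hom1 br_Hom3 zero_fun_def)
  note L = shift_linear_ext1[OF psi]
  note lin1 = shift_linear_compose[OF L shift_linear_ext1[OF const(1)]]
    shift_linear_compose[OF shift_linear_ext1[OF T_t_Hom1] L]
  note C = shift_linear_ext3[OF const(2), THEN shift_linear_compose[OF L]]
  note N = shift_linear_compose[OF shift_linear_ext3(1)[OF mu_t_Hom3] L]
    shift_linear_compose[OF shift_linear_ext3(2)[OF mu_t_Hom3] L]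
    shift_linear_compose[OF shift_linear_ext3(3)[OF mu_t_Hom3] L]
  let ?D = "\<lambda>X Y Z. ext1 psi (ext3 (const_series mu) X Y Z) - M (ext1 psi X) (ext1 psi Y) (ext1 psi Z)"
  \<comment> \<open>On constants \<open>?D\<close> is the negative of \<open>defect3\<close>. The
    next three steps free one argument at a time, from the last to the first, by shift-linearity in
    that argument.\<close>
  have "?D (fps_const x) (fps_const y) (fps_const z) = 0" for x y z
    using defect(1)[of x y z] by (simp add: fps_app ext3_const_series[OF br_Hom3] defect3_def)
  then have "?D (fps_const x) (fps_const y) Z = 0" for x y Z
    by (rule shift_linear_eq_0[OF shift_linear_diff[OF C(3) N(3)]])
  then have "?D (fps_const x) Y Z = 0" for x Y Z
    by (rule shift_linear_eq_0[OF shift_linear_diff[OF C(2) N(2)]])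
  then have "?D X Y Z = 0" for X Y Z
    by (rule shift_linear_eq_0[OF shift_linear_diff[OF C(1) N(1)]])
  moreover have "ext1 psi (ext1 (const_series T) (fps_const x)) - TT (ext1 psi (fps_const x)) = 0" for x
    using defect(2)[of x] by (simp add: fps_app ext1_const_series[of T, OF Hom1_0[OF T_Hom1]] defect1_def)
  then have "ext1 psi (ext1 (const_series T) X) - TT (ext1 psi X) = 0" for X
    by (rule shift_linear_eq_0[OF shift_linear_diff[OF lin1]])
  ultimately show ?thesis
    using psi psi_0
    by (auto simp: trivial_deformation_def equivalent_deformations_def fun_eq_iff intro!: exI[of _ psi])
qed

end

theorem theorem4p10:
  fixes scale :: "'k::field_char_0 \<Rightarrow> 'g::ab_group_add \<Rightarrow> 'g"
    and mu :: "'g \<Rightarrow> 'g \<Rightarrow> 'g \<Rightarrow> 'g"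
    and lam :: 'k
    and T :: "'g \<Rightarrow> 'g"
  assumes "vector_space scale"
    and "rota_baxter_lie3_algebra scale mu lam T"
    and "trivial_group (cohomology2 scale mu lam T)"
  shows "rigid scale mu lam T"
  unfolding rigid_def
proof (intro allI impI)
  fix mu_t T_t assume "formal_deformation scale mu lam T mu_t T_t"
  then interpret deformation_of_rota_baxter scale mu lam T mu_t T_t
    using assms(2) by (simp add: deformation_of_rota_baxter_def deformation_of_rota_baxter_axioms_def)
  have "cocycles2 scale mu lam T \<subseteq> coboundaries2 scale mu T"
    using coboundary_if_trivial_cohomology2[OF assms(2,3)] by blast
  then show "trivial_deformation scale mu T mu_t T_t"
    using intertwiner_exists trivial_if_intertwiner by metis
qed

end
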